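(* Let $P$ be a finite set of points in the Euclidean plane with $|P|$ even, and let $M$ be a $3$-local maximum perfect matching on $P$. Let $M^*$ be a maximum-length perfect matching on $P$. Then $w(M)\geqslant \frac{1}{\sqrt{2}}\, w(M^* )$.
   Context: A perfect matching on a finite point set $P$ in the plane is a partition of $P$ into pairs; each pair $\{a,b\}$ is regarded as the straight-line segment (edge) $ab$. For a set $E$ of segments, $w(E)$ denotes the sum of the Euclidean lengths of its segments. A perfect matching $M$ on $P$ is a maximum-length (globally maximum) matching if $w(M)\geqslant w(M')$ for every perfect matching $M'$ on $P$. For an integer $k$, a perfect matching $M$ is $k$-local maximum if for every subset $M'=\{a_1b_1,\dots,a_kb_k\}$ of $k$ edges of $M$, $M'$ is a maximum-length perfect matching on the point set $\{a_1,b_1,\dots,a_k,b_k\}$.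
   Formalization: 3-local maximum is read as: every subset of at most 3 edges of M is maximum on its endpoints. With exactly 3 edges the condition is void when M has 2 edges and the claim fails (collinear points 0,1,2,3 matched 01, 23: ratio 1/2); for 3 or more edges the readings agree. *)

theory Defs
  imports "HOL-Analysis.Analysis"
begin

type_synonym point = "real ^ 2"

text \<open>An edge (segment) is a two-element set of points; its length is the
  distance between its two endpoints.\<close>
definition seg_len :: "point set \<Rightarrow> real" where
  "seg_len e = Max ((\<lambda>(a, b). dist a b) ` (e \<times> e))"

definition w :: "point set set \<Rightarrow> real" where
  "w E = (\<Sum>e\<in>E. seg_len e)"

definition perfect_matching :: "point set \<Rightarrow> point set set \<Rightarrow> bool" where
  "perfect_matching P M \<longleftrightarrow>
     (\<forall>e\<in>M. card e = 2) \<and>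
     (\<forall>e\<in>M. \<forall>f\<in>M. e \<noteq> f \<longrightarrow> e \<inter> f = {}) \<and>
     \<Union>M = P"

definition max_matching :: "point set \<Rightarrow> point set set \<Rightarrow> bool" where
  "max_matching P M \<longleftrightarrow> perfect_matching P M \<and>
     (\<forall>M'. perfect_matching P M' \<longrightarrow> w M' \<le> w M)"

text \<open>k-local maximum: every choice of k edges a_1b_1,...,a_kb_k of M (not
  necessarily distinct, i.e. every set of at most k edges) is a maximum
  matching on its own endpoints.\<close>
definition local_max :: "nat \<Rightarrow> point set \<Rightarrow> point set set \<Rightarrow> bool" where
  "local_max k P M \<longleftrightarrow> perfect_matching P M \<and>
     (\<forall>M'. M' \<subseteq> M \<and> card M' \<le> k \<longrightarrow> max_matching (\<Union>M') M')"

end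

theory Submission
  imports Defs
begin

text \<open>Choose a point $x$ minimising the maximum over the edges $ab$ of $M$ of the excess
  $|xa| + |xb| - \sqrt 2 |ab|$. If the minimum is at most $0$, then
  $w(M^*) \le \sum_{p \in P} |xp| \le \sqrt 2\, w(M)$ by the triangle inequality.

  Otherwise every edge of maximal excess subtends an acute angle at $x$, because
  $|xa| + |xb| \le \sqrt 2 |ab|$ as soon as the angle at $x$ is not acute. By minimality, $0$ lies
  in the convex hull of the gradients of the maximal excesses, and these point along the bisectors
  of the angles. By Caratheodory three bisectors already have $0$ in their convex hull, and an
  angle count shows that two of the three edges can be replaced by two segments that subtend
  non-acute angles at $x$. The new segments are longer in total, against local maximality.\<close>

section \<open>Matchings and segments\<close>

lemma seg_len_pair: "seg_len {a, b} = dist a b"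
proof -
  have "(\<lambda>(a, b). dist a b) ` ({a, b} \<times> {a, b}) = {0, dist a b}"
    by (auto simp: dist_commute image_iff)
  then show ?thesis
    by (simp add: seg_len_def max_def)
qed

lemma perfect_matching_edgeE:
  assumes "perfect_matching P M" "e \<in> M"
  obtains a b where "e = {a, b}" "a \<noteq> b" "seg_len e = dist a b"
  using assms unfolding perfect_matching_def by (metis card_2_iff seg_len_pair)

lemma perfect_matching_finite:
  assumes "perfect_matching P M" "finite P"
  shows "finite M"
  using assms finite_UnionD unfolding perfect_matching_def by blast

lemma sum_perfect_matching:
  assumes "perfect_matching P M" "finite P"
  shows "(\<Sum>e\<in>M. \<Sum>p\<in>e. f p) = (\<Sum>p\<in>P. f p)"
proof -
  have "\<forall>e\<in>M. finite e"
    using assms(1) unfolding perfect_matching_def by (metis card.infinite zero_neq_numeral)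
  then have "sum f (\<Union>M) = (\<Sum>e\<in>M. \<Sum>p\<in>e. f p)"
    using assms(1) unfolding perfect_matching_def by (subst sum.Union_disjoint) auto
  then show ?thesis
    using assms(1) unfolding perfect_matching_def by simp
qed

text \<open>Each point of \<open>P\<close> is an end of exactly one edge, and the triangle
  inequality through \<open>x\<close> bounds an edge by the distances of its ends to
  \<open>x\<close>.\<close>

lemma w_le_sum_dist:
  assumes "perfect_matching P M" "finite P"
  shows "w M \<le> (\<Sum>p\<in>P. dist x p)"
proof -
  have "w M \<le> (\<Sum>e\<in>M. \<Sum>p\<in>e. dist x p)"
    unfolding w_def
  proof (rule sum_mono)
    fix e assume "e \<in> M"
    then obtain a b where "e = {a, b}" "a \<noteq> b" "seg_len e = dist a b"
      using assms(1) perfect_matching_edgeE by blast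
    then show "seg_len e \<le> (\<Sum>p\<in>e. dist x p)"
      using dist_triangle3[of a b x] by simp
  qed
  then show ?thesis
    by (simp only: sum_perfect_matching[OF assms])
qed

text \<open>The form in which local maximality enters the argument. Distinct edges are disjoint, so
  \<open>{{a, c}, {b, d}}\<close> matches the same four points.\<close>

lemma local_max_swap:
  assumes "local_max k P M" "2 \<le> k" "{a, b} \<in> M" "{c, d} \<in> M"
    and "{a, b} \<noteq> {c, d}" "a \<noteq> b" "c \<noteq> d"
  shows "dist a c + dist b d \<le> dist a b + dist c d"
proof -
  have dj: "{a, b} \<inter> {c, d} = {}"
    using assms(1,3-5) unfolding local_max_def perfect_matching_def by metis
  have "{{a, b}, {c, d}} \<subseteq> M \<and> card {{a, b}, {c, d}} \<le> k"
    using assms by simp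
  then have mm: "max_matching (\<Union>{{a, b}, {c, d}}) {{a, b}, {c, d}}"
    using assms(1) unfolding local_max_def by blast
  have pm: "perfect_matching (\<Union>{{a, b}, {c, d}}) {{a, c}, {b, d}}"
    using dj assms(6,7) unfolding perfect_matching_def by auto
  have "w {{a, c}, {b, d}} \<le> w {{a, b}, {c, d}}"
    using mm pm unfolding max_matching_def by blast
  \<comment> \<open>\<open>w\<close> sums over a set, so both new lengths count only if the two
    edges differ.\<close>
  moreover have "{a, c} \<noteq> {b, d}"
    using dj assms(6) by (auto simp: doubleton_eq_iff)
  ultimately show ?thesis
    using assms(5) by (simp add: w_def seg_len_pair)
qed

section \<open>Obtuse and acute pairs\<close>

text \<open>Without an acute angle, the squared distance is at least the sum of the squared norms,
  and twice that sum bounds the square of \<open>norm u + norm v\<close>.\<close>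

lemma sum_norm_le_sqrt2_dist:
  fixes u v :: "'a::real_inner"
  assumes "u \<bullet> v \<le> 0"
  shows "norm u + norm v \<le> sqrt 2 * dist u v"
proof -
  have "(norm u + norm v)\<^sup>2 \<le> 2 * ((norm u)\<^sup>2 + (norm v)\<^sup>2)"
    using sum_squares_ge_zero[of "norm u - norm v" 0]
    by (simp add: power2_eq_square algebra_simps)
  also have "\<dots> \<le> 2 * (dist u v)\<^sup>2"
    using assms by (simp add: dist_norm power2_norm_eq_inner algebra_simps inner_commute)
  finally have "(norm u + norm v)\<^sup>2 \<le> (sqrt 2 * dist u v)\<^sup>2"
    by (simp add: power_mult_distrib)
  then show ?thesis
    by (rule power2_le_imp_le) simp
qed

definition dir :: "real \<Rightarrow> real^2" where
  "dir t = vector [cos t, sin t]"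

lemma inner_dir: "dir s \<bullet> dir t = cos (s - t)"
  by (simp add: dir_def inner_vec_def sum_2 cos_diff)

lemma unit_vector_dirE:
  fixes u :: "real^2"
  assumes "norm u = 1"
  obtains t where "0 \<le> t" "t < 2 * pi" "u = dir t"
proof -
  have "(u $ 1)\<^sup>2 + (u $ 2)\<^sup>2 = 1"
    using assms by (simp add: norm_eq_1 inner_vec_def sum_2 power2_eq_square)
  then obtain t where "0 \<le> t" "t < 2 * pi" "u $ 1 = cos t" "u $ 2 = sin t"
    by (rule sincos_total_2pi)
  then show ?thesis
    by (intro that[of t]) (auto simp: dir_def vec_eq_iff forall_2)
qed

lemma norm_dir: "norm (dir t) = 1"
  by (simp add: norm_eq_1 inner_dir)

lemma dir_add_eq:
  assumes "dir s = dir t"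
  shows "dir (s + x) = dir (t + x)"
proof -
  have "cos s = cos t" "sin s = sin t"
    using assms by (auto simp: dir_def vec_eq_iff forall_2)
  then show ?thesis
    by (simp add: dir_def cos_add sin_add)
qed

lemma dir_plus_dir: "dir (t - x) + dir (t + x) = (2 * cos x) *\<^sub>R dir t"
  by (simp add: dir_def vec_eq_iff forall_2 cos_add cos_diff sin_add sin_diff)

text \<open>For \<open>0 \<le> \<alpha> < pi / 4\<close>, \<open>\<theta>\<close> is the direction
  of the bisector at \<open>x\<close> and \<open>\<alpha>\<close> is half the angle. Edges are
  unordered, so the endpoints are labelled existentially.\<close>

definition subtends :: "point \<Rightarrow> point set \<Rightarrow> real \<Rightarrow> real \<Rightarrow> bool" where
  "subtends x e \<theta> \<alpha> \<longleftrightarrow> (\<exists>a b. e = {a, b} \<and> a \<noteq> b \<and> a \<noteq> x \<and> b \<noteq> x \<and>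
     sgn (a - x) = dir (\<theta> - \<alpha>) \<and> sgn (b - x) = dir (\<theta> + \<alpha>))"

lemma acute_subtends:
  fixes a b x :: point
  assumes "a \<noteq> b" and acute: "(a - x) \<bullet> (b - x) > 0"
  obtains \<theta> \<alpha> where "0 \<le> \<theta>" "\<theta> < 2 * pi" "0 \<le> \<alpha>" "\<alpha> < pi / 4" "subtends x {a, b} \<theta> \<alpha>"
proof -
  have ne: "a \<noteq> x" "b \<noteq> x"
    using acute by auto
  obtain s where s: "0 \<le> s" "s < 2 * pi" "sgn (a - x) = dir s"
    using unit_vector_dirE[of "sgn (a - x)"] ne by (auto simp: norm_sgn)
  obtain t where t: "0 \<le> t" "t < 2 * pi" "sgn (b - x) = dir t"
    using unit_vector_dirE[of "sgn (b - x)"] ne by (auto simp: norm_sgn)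
  have "sgn (a - x) \<bullet> sgn (b - x) > 0"
    using acute ne by (simp add: sgn_div_norm)
  then have cos_pos: "cos (s - t) > 0"
    by (simp add: s t inner_dir)
  have *: "\<exists>\<theta> \<alpha>. 0 \<le> \<alpha> \<and> \<alpha> < pi / 4 \<and> (dir s = dir (\<theta> - \<alpha>) \<and> dir t = dir (\<theta> + \<alpha>) \<or>
             dir t = dir (\<theta> - \<alpha>) \<and> dir s = dir (\<theta> + \<alpha>))"
    if le: "s \<le> t" and s: "0 \<le> s" and t: "t < 2 * pi" and pos: "cos (t - s) > 0" for s t :: real
  proof -
    consider "t - s < pi / 2" | "pi / 2 \<le> t - s" "t - s \<le> 3 * pi / 2" | "3 * pi / 2 < t - s"
      by linarith
    then show ?thesis
    proof cases
      case 1
      then show ?thesis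
        using le by (intro exI[of _ "(s + t) / 2"] exI[of _ "(t - s) / 2"]) (auto simp: field_simps)
    next
      case 2
      have "cos (t - s - pi) \<ge> 0"
        using 2 by (intro cos_ge_zero) auto
      then show ?thesis
        using pos by (simp add: cos_diff)
    next
      case 3
      \<comment> \<open>The acute angle now wraps around direction 0: it runs from \<open>t\<close>
        to \<open>s + 2 * pi\<close>, with midpoint \<open>\<theta>\<close> and half-length
        \<open>\<alpha>\<close>.\<close>
      define \<theta> \<alpha> where "\<theta> = (s + t) / 2 + pi" and "\<alpha> = (s - t) / 2 + pi"
      have "\<theta> - \<alpha> = t" "\<theta> + \<alpha> = s + 2 * pi"
        by (simp_all add: \<theta>_def \<alpha>_def field_simps)
      then have "dir t = dir (\<theta> - \<alpha>)" "dir s = dir (\<theta> + \<alpha>)"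
        by (simp_all add: dir_def)
      moreover have "0 \<le> \<alpha>" "\<alpha> < pi / 4"
        using 3 s t by (simp_all add: \<alpha>_def field_simps)
      ultimately show ?thesis
        by blast
    qed
  qed
  have "\<exists>\<theta> \<alpha>. 0 \<le> \<alpha> \<and> \<alpha> < pi / 4 \<and> (dir s = dir (\<theta> - \<alpha>) \<and> dir t = dir (\<theta> + \<alpha>) \<or>
             dir t = dir (\<theta> - \<alpha>) \<and> dir s = dir (\<theta> + \<alpha>))"
  proof (cases "s \<le> t")
    case True
    have "cos (t - s) > 0"
      using cos_pos cos_minus[of "s - t"] by simp
    then show ?thesis
      using *[of s t] True s t by simp
  next
    case False
    then show ?thesis
      using *[of t s] cos_pos s t by force
  qed
  then obtain \<theta> \<alpha> where \<alpha>: "0 \<le> \<alpha>" "\<alpha> < pi / 4"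
    and st: "dir s = dir (\<theta> - \<alpha>) \<and> dir t = dir (\<theta> + \<alpha>) \<or> dir t = dir (\<theta> - \<alpha>) \<and> dir s = dir (\<theta> + \<alpha>)"
    by blast
  \<comment> \<open>In the wrap-around case the midpoint can reach \<open>2 * pi\<close> or more, so
    it is reduced to the standard range.\<close>
  obtain \<phi> where \<phi>: "0 \<le> \<phi>" "\<phi> < 2 * pi" "dir \<theta> = dir \<phi>"
    using unit_vector_dirE[OF norm_dir] by metis
  have "dir (\<theta> - \<alpha>) = dir (\<phi> - \<alpha>)" "dir (\<theta> + \<alpha>) = dir (\<phi> + \<alpha>)"
    using dir_add_eq[OF \<phi>(3), of "- \<alpha>"] dir_add_eq[OF \<phi>(3), of \<alpha>] by simp_all
  with st have "dir s = dir (\<phi> - \<alpha>) \<and> dir t = dir (\<phi> + \<alpha>) \<or>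
      dir t = dir (\<phi> - \<alpha>) \<and> dir s = dir (\<phi> + \<alpha>)"
    by simp
  then have "subtends x {a, b} \<phi> \<alpha>"
  proof
    assume "dir s = dir (\<phi> - \<alpha>) \<and> dir t = dir (\<phi> + \<alpha>)"
    then show ?thesis
      unfolding subtends_def using ne assms(1) s(3) t(3)
      by (intro exI[of _ a] exI[of _ b]) simp
  next
    assume "dir t = dir (\<phi> - \<alpha>) \<and> dir s = dir (\<phi> + \<alpha>)"
    then show ?thesis
      unfolding subtends_def using ne assms(1) s(3) t(3)
      by (intro exI[of _ b] exI[of _ a]) (simp add: insert_commute)
  qed
  then show ?thesis
    using that \<phi> \<alpha> by blast
qed

section \<open>Three directions that positively span\<close>

text \<open>All three directions have positive inner product with the middle direction
  \<open>dir m\<close> of an arc shorter than \<open>pi\<close>.\<close>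

lemma positive_combination_no_half_plane:
  assumes "c1 > 0" "c2 > 0" "c3 > 0"
    and "c1 *\<^sub>R dir t1 + c2 *\<^sub>R dir t2 + c3 *\<^sub>R dir t3 = 0"
    and "t1 \<in> {l..u}" "t2 \<in> {l..u}" "t3 \<in> {l..u}" "u - l < pi"
  shows False
proof -
  define m where "m = (l + u) / 2"
  have near: "- (pi / 2) < t - m \<and> t - m < pi / 2" if "t \<in> {l..u}" for t
    using that assms(8) by (simp add: m_def field_simps)
  have "cos (t1 - m) > 0" "cos (t2 - m) > 0" "cos (t3 - m) > 0"
    using near[OF assms(5)] near[OF assms(6)] near[OF assms(7)]
    by (simp_all only: cos_gt_zero_pi)
  then have "c1 * cos (t1 - m) + c2 * cos (t2 - m) + c3 * cos (t3 - m) > 0"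
    using assms(1-3) by (simp add: add_pos_pos)
  moreover have "c1 * cos (t1 - m) + c2 * cos (t2 - m) + c3 * cos (t3 - m) =
      (c1 *\<^sub>R dir t1 + c2 *\<^sub>R dir t2 + c3 *\<^sub>R dir t3) \<bullet> dir m"
    by (simp add: inner_add_left inner_dir)
  ultimately show False
    using assms(4) by simp
qed

text \<open>Two edges subtending $s \pm x$ and $t \pm y$ are recombined into the segments with
  directions $s - x, t - y$ and $s + x, t + y$; neither of these is seen under an acute angle.\<close>
definition swappable :: "real \<Rightarrow> real \<Rightarrow> real \<Rightarrow> real \<Rightarrow> bool" where
  "swappable s x t y \<longleftrightarrow> cos ((s - x) - (t - y)) \<le> 0 \<and> cos ((s + x) - (t + y)) \<le> 0"

lemma swappable_sym: "swappable s x t y \<longleftrightarrow> swappable t y s x"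
  unfolding swappable_def by (metis cos_minus minus_diff_eq)

text \<open>Up to sign, the two angles are \<open>t - s + (x - y)\<close> and
  \<open>t - s - (x - y)\<close>. The bounds put both between \<open>pi / 2\<close> and
  \<open>3 * pi / 2\<close>, where the cosine is not positive.\<close>

lemma swappableI:
  assumes "pi / 2 + \<bar>x - y\<bar> \<le> t - s" "t - s \<le> 3 * pi / 2 - \<bar>x - y\<bar>"
  shows "swappable s x t y"
proof -
  have "cos r \<le> 0" if "pi / 2 \<le> - r" "- r \<le> 3 * pi / 2" for r :: real
  proof -
    have "cos (r + pi) \<ge> 0"
      using that by (intro cos_ge_zero) auto
    then show ?thesis
      by simp
  qed
  then show ?thesis
    using assms unfolding swappable_def by (auto simp: abs_if split: if_splits)
qed

text \<open>The cyclic gaps \<open>t2 - t1\<close>, \<open>t3 - t2\<close> and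
  \<open>2 * pi - (t3 - t1)\<close> are each at most \<open>pi\<close>, so only their lower bounds
  matter. For the last gap, this lower bound is the upper bound on \<open>t3 - t1\<close>.\<close>

lemma swappable_of_sorted:
  assumes c: "c1 > 0" "c2 > 0" "c3 > 0"
    and z: "c1 *\<^sub>R dir t1 + c2 *\<^sub>R dir t2 + c3 *\<^sub>R dir t3 = 0"
    and t: "t1 \<le> t2" "t2 \<le> t3" "t3 < t1 + 2 * pi"
    and x: "0 \<le> x1" "x1 < pi / 4" "0 \<le> x2" "x2 < pi / 4" "0 \<le> x3" "x3 < pi / 4"
  shows "swappable t1 x1 t2 x2 \<or> swappable t2 x2 t3 x3 \<or> swappable t1 x1 t3 x3"
proof -
  have per: "dir (t + 2 * pi) = dir t" for t
    by (simp add: dir_def)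
  \<comment> \<open>A larger gap would place \<open>t2\<close>, \<open>t3\<close> and
    \<open>t1 + 2 * pi\<close> in an interval shorter than \<open>pi\<close>; the other two gaps are
    treated alike.\<close>
  have g1: "t2 - t1 \<le> pi"
  proof (rule ccontr)
    assume "\<not> ?thesis"
    then show False
      using t z positive_combination_no_half_plane[OF c, of "t1 + 2 * pi" t2 t3 t2 "t1 + 2 * pi"]
      by (simp add: per)
  qed
  have g2: "t3 - t2 \<le> pi"
  proof (rule ccontr)
    assume "\<not> ?thesis"
    then show False
      using t z positive_combination_no_half_plane[OF c, of "t1 + 2 * pi" "t2 + 2 * pi" t3 t3 "t2 + 2 * pi"]
      by (simp add: per)
  qed
  have g3: "t3 - t1 \<ge> pi"
  proof (rule ccontr)
    assume "\<not> ?thesis"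
    then show False
      using t z positive_combination_no_half_plane[OF c, of t1 t2 t3 t1 "t3"]
      by (simp add: per)
  qed
  text \<open>The excesses of the three gaps over $\pi/2$ add up to $\pi/2$, while the differences of the
    half-angles add up to twice their range, which is less than $\pi/2$.\<close>
  have "pi / 2 + \<bar>x1 - x2\<bar> \<le> t2 - t1 \<and> t2 - t1 \<le> 3 * pi / 2 - \<bar>x1 - x2\<bar> \<or>
        pi / 2 + \<bar>x2 - x3\<bar> \<le> t3 - t2 \<and> t3 - t2 \<le> 3 * pi / 2 - \<bar>x2 - x3\<bar> \<or>
        pi / 2 + \<bar>x1 - x3\<bar> \<le> t3 - t1 \<and> t3 - t1 \<le> 3 * pi / 2 - \<bar>x1 - x3\<bar>"
    using g1 g2 g3 x t by argo
  then show ?thesis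
    using swappableI by blast
qed

lemma swappable_of_positive_combination:
  assumes c: "c1 > 0" "c2 > 0" "c3 > 0"
    and z: "c1 *\<^sub>R dir t1 + c2 *\<^sub>R dir t2 + c3 *\<^sub>R dir t3 = 0"
    and t: "0 \<le> t1" "t1 < 2 * pi" "0 \<le> t2" "t2 < 2 * pi" "0 \<le> t3" "t3 < 2 * pi"
    and x: "0 \<le> x1" "x1 < pi / 4" "0 \<le> x2" "x2 < pi / 4" "0 \<le> x3" "x3 < pi / 4"
  shows "swappable t1 x1 t2 x2 \<or> swappable t2 x2 t3 x3 \<or> swappable t1 x1 t3 x3"
proof -
  consider "t1 \<le> t2" "t2 \<le> t3" | "t1 \<le> t3" "t3 \<le> t2" | "t2 \<le> t1" "t1 \<le> t3"
    | "t2 \<le> t3" "t3 \<le> t1" | "t3 \<le> t1" "t1 \<le> t2" | "t3 \<le> t2" "t2 \<le> t1"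
    by linarith
  then show ?thesis
  proof cases
    case 1
    then show ?thesis
      using swappable_of_sorted[of c1 c2 c3 t1 t2 t3 x1 x2 x3] assms by auto
  next
    case 2
    then show ?thesis
      using swappable_of_sorted[of c1 c3 c2 t1 t3 t2 x1 x3 x2] assms swappable_sym
      by (auto simp: add_ac)
  next
    case 3
    then show ?thesis
      using swappable_of_sorted[of c2 c1 c3 t2 t1 t3 x2 x1 x3] assms swappable_sym
      by (auto simp: add_ac)
  next
    case 4
    then show ?thesis
      using swappable_of_sorted[of c2 c3 c1 t2 t3 t1 x2 x3 x1] assms swappable_sym
      by (auto simp: add_ac)
  next
    case 5
    then show ?thesis
      using swappable_of_sorted[of c3 c1 c2 t3 t1 t2 x3 x1 x2] assms swappable_sym
      by (auto simp: add_ac)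
  next
    case 6
    then show ?thesis
      using swappable_of_sorted[of c3 c2 c1 t3 t2 t1 x3 x2 x1] assms swappable_sym
      by (auto simp: add_ac)
  qed
qed

section \<open>Zero in the convex hull of a planar set\<close>

text \<open>The three points may coincide, which absorbs the cases of fewer than three points.\<close>
lemma zero_in_convex_hull_planarE:
  fixes S :: "(real^2) set"
  assumes "0 \<in> convex hull S"
  obtains x y z p q r where "x \<in> S" "y \<in> S" "z \<in> S" "p > 0" "q > 0" "r > 0"
    "p *\<^sub>R x + q *\<^sub>R y + r *\<^sub>R z = 0"
proof -
  obtain T u where T: "finite T" "T \<subseteq> S" "card T \<le> 3" "\<forall>x\<in>T. 0 \<le> u x" "sum u T = 1"
    and z: "(\<Sum>v\<in>T. u v *\<^sub>R v) = 0"
    using assms unfolding convex_hull_caratheodory by auto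
  \<comment> \<open>Dropping zero coefficients makes all remaining weights strictly
    positive.\<close>
  define U where "U = {x\<in>T. u x > 0}"
  have U: "finite U" "U \<subseteq> S" "card U \<le> 3" "\<forall>x\<in>U. u x > 0"
    using T card_mono[of T U] unfolding U_def by auto
  have "sum u U = sum u T"
    using T unfolding U_def by (intro sum.mono_neutral_left) (auto simp: not_less intro: antisym)
  then have "U \<noteq> {}"
    using T by auto
  have zU: "(\<Sum>v\<in>U. u v *\<^sub>R v) = 0"
    using T unfolding z[symmetric] U_def
    by (intro sum.mono_neutral_left) (auto simp: not_less intro: antisym)
  have "card U \<noteq> 0"
    using U \<open>U \<noteq> {}\<close> by simp
  then consider "card U = 1" | "card U = 2" | "card U = 3"
    using U(3) by linarith
  then show ?thesis
  proof cases
    case 1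
    then obtain x where x: "U = {x}"
      by (rule card_1_singletonE)
    show ?thesis
      \<comment> \<open>A single point with positive weight and zero combination is \<open>0\<close>
        itself, so any weights serve.\<close>
      using that[of x x x 1 1 1] x zU U by auto
  next
    case 2
    then obtain x y where x: "U = {x, y}" "x \<noteq> y"
      by (auto simp: card_2_iff)
    \<comment> \<open>The weight of \<open>y\<close> is split in half to produce three positive
      weights.\<close>
    have "u x *\<^sub>R x + (u y / 2) *\<^sub>R y + (u y / 2) *\<^sub>R y = 0"
      using x zU by (simp flip: scaleR_left_distrib add: add.assoc)
    then show ?thesis
      using that[of x y y "u x" "u y / 2" "u y / 2"] x U by auto
  next
    case 3
    then obtain x y z where x: "U = {x, y, z}" "x \<noteq> y" "x \<noteq> z" "y \<noteq> z"
      by (auto simp: card_3_iff)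
    show ?thesis
      using that[of x y z "u x" "u y" "u z"] x zU U by (auto simp: add.assoc)
  qed
qed

section \<open>Minimising the largest excess\<close>

text \<open>For an edge \<open>e\<close>, the condition \<open>excess e x \<le> 0\<close> says that
  \<open>x\<close> lies in the filled ellipse with foci at the ends of \<open>e\<close> and
  eccentricity \<open>1 / sqrt 2\<close>.\<close>

definition excess :: "point set \<Rightarrow> point \<Rightarrow> real" where
  "excess e x = (\<Sum>p\<in>e. dist x p) - sqrt 2 * seg_len e"

lemma excess_pair:
  "a \<noteq> b \<Longrightarrow> excess {a, b} x = dist x a + dist x b - sqrt 2 * dist a b"
  by (simp add: excess_def seg_len_pair)

text \<open>At an endpoint the excess is \<open>(1 - sqrt 2) * dist a b\<close>, which is negative.
  This secures differentiability wherever the excess is positive.\<close>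

lemma excess_pos_not_endpoint:
  assumes "a \<noteq> b" "excess {a, b} x > 0"
  shows "x \<noteq> a" "x \<noteq> b"
proof -
  have "dist a b \<le> sqrt 2 * dist a b"
    by (simp add: mult_le_cancel_right1)
  then show "x \<noteq> a" "x \<noteq> b"
    using assms by (auto simp: excess_pair dist_commute)
qed

lemma excess_pos_acute:
  assumes "a \<noteq> b" "excess {a, b} x > 0"
  shows "(a - x) \<bullet> (b - x) > 0"
proof (rule ccontr)
  assume "\<not> ?thesis"
  then have "norm (a - x) + norm (b - x) \<le> sqrt 2 * dist (a - x) (b - x)"
    by (intro sum_norm_le_sqrt2_dist) simp
  then show False
    using assms by (simp add: excess_pair dist_norm norm_minus_commute)
qed

text \<open>Away from \<open>p\<close>, the distance to \<open>p\<close> has as gradient the unit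
  vector pointing away from \<open>p\<close>, and the length term is constant.\<close>

lemma has_derivative_excess:
  assumes "finite e" "x \<notin> e"
  shows "(excess e has_derivative (\<lambda>h. - ((\<Sum>p\<in>e. sgn (p - x)) \<bullet> h))) (at x)"
proof -
  have "((\<lambda>y. norm (y - p)) has_derivative (\<lambda>h. - (sgn (p - x) \<bullet> h))) (at x)" if "p \<in> e" for p
  proof -
    have "x - p \<noteq> 0"
      using that assms by auto
    then have "((\<lambda>y. norm (y - p)) has_derivative (\<lambda>h. (h - 0) \<bullet> sgn (x - p))) (at x)"
      by (intro has_derivative_compose[OF _ has_derivative_norm] derivative_intros)
    moreover have "(h - 0) \<bullet> sgn (x - p) = - (sgn (p - x) \<bullet> h)" for h
      by (metis diff_zero inner_commute inner_minus_left minus_diff_eq sgn_minus)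
    ultimately show ?thesis
      by simp
  qed
  then have "((\<lambda>y. \<Sum>p\<in>e. norm (y - p)) has_derivative (\<lambda>h. \<Sum>p\<in>e. - (sgn (p - x) \<bullet> h))) (at x)"
    by (rule has_derivative_sum)
  then have "((\<lambda>y. (\<Sum>p\<in>e. norm (y - p)) - sqrt 2 * seg_len e) has_derivative
      (\<lambda>h. (\<Sum>p\<in>e. - (sgn (p - x) \<bullet> h)) - 0)) (at x)"
    by (intro has_derivative_diff has_derivative_const)
  then show ?thesis
    by (simp add: excess_def[abs_def] dist_norm inner_sum_left sum_negf)
qed

lemma excess_decreases:
  assumes "finite e" "x \<notin> e" "(\<Sum>p\<in>e. sgn (p - x)) \<bullet> d > 0"
  shows "\<forall>\<^sub>F t in at_right 0. excess e (x + t *\<^sub>R d) < excess e x"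
proof -
  have "((\<lambda>t. x + t *\<^sub>R d) has_derivative (\<lambda>t. t *\<^sub>R d)) (at (0::real))"
    by (auto intro!: derivative_eq_intros)
  then have "((\<lambda>t. excess e (x + t *\<^sub>R d)) has_derivative
      (\<lambda>t. - ((\<Sum>p\<in>e. sgn (p - x)) \<bullet> (t *\<^sub>R d)))) (at 0)"
    by (rule has_derivative_compose) (use has_derivative_excess[OF assms(1,2)] in simp)
  moreover have "(\<lambda>t. - ((\<Sum>p\<in>e. sgn (p - x)) \<bullet> (t *\<^sub>R d))) =
      (*) (- ((\<Sum>p\<in>e. sgn (p - x)) \<bullet> d))"
    by (auto simp: fun_eq_iff)
  ultimately have "DERIV (\<lambda>t. excess e (x + t *\<^sub>R d)) 0 :> - ((\<Sum>p\<in>e. sgn (p - x)) \<bullet> d)"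
    by (simp add: has_field_derivative_def)
  from DERIV_neg_dec_right[OF this] assms(3)
  obtain r where r: "r > 0" "\<forall>t>0. t < r \<longrightarrow> excess e (x + t *\<^sub>R d) < excess e x"
    by auto
  then show ?thesis
    unfolding eventually_at_right_field by auto
qed

lemma continuous_on_Max_image:
  fixes f :: "'i \<Rightarrow> 'a::topological_space \<Rightarrow> real"
  assumes "finite I" "I \<noteq> {}" "\<And>i. i \<in> I \<Longrightarrow> continuous_on S (f i)"
  shows "continuous_on S (\<lambda>x. Max ((\<lambda>i. f i x) ` I))"
  using assms by (induction rule: finite_ne_induct) (auto intro!: continuous_on_max)

lemma continuous_on_excess: "continuous_on S (excess e)"
  unfolding excess_def[abs_def] by (intro continuous_intros)

text \<open>The maximum is continuous and coercive: one edge already makes it large far away, so a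
  minimum over a compact ball is global.\<close>

lemma max_excess_attains_min:
  assumes "finite M" "e0 \<in> M" "finite e0" "e0 \<noteq> {}"
  obtains x where "\<And>y. Max ((\<lambda>e. excess e x) ` M) \<le> Max ((\<lambda>e. excess e y) ` M)"
proof -
  define h where "h x = Max ((\<lambda>e. excess e x) ` M)" for x
  obtain a where a: "a \<in> e0"
    using assms by auto
  \<comment> \<open>Chosen so that a point further than \<open>R\<close> from \<open>a\<close> has
    excess of \<open>e0\<close> above \<open>h a\<close>.\<close>
  define R where "R = \<bar>h a\<bar> + sqrt 2 * \<bar>seg_len e0\<bar>"
  have "R \<ge> 0"
    by (simp add: R_def)
  have "continuous_on (cball a R) h"
    unfolding h_def using assms by (intro continuous_on_Max_image continuous_on_excess) auto
  then obtain x where x: "x \<in> cball a R" "\<forall>y\<in>cball a R. h x \<le> h y"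
    using continuous_attains_inf[of "cball a R" h] \<open>R \<ge> 0\<close> by auto
  have "h x \<le> h y" for y
  proof (cases "y \<in> cball a R")
    case False
    have "dist y a \<le> (\<Sum>p\<in>e0. dist y p)"
      using a assms by (intro member_le_sum) auto
    moreover have "dist y a > R"
      using False by (simp add: dist_commute)
    moreover have "sqrt 2 * seg_len e0 \<le> sqrt 2 * \<bar>seg_len e0\<bar>"
      by simp
    ultimately have "h a < excess e0 y"
      unfolding excess_def R_def by linarith
    also have "\<dots> \<le> h y"
      unfolding h_def using assms by (intro Max_ge) auto
    finally show ?thesis
      using x(2) \<open>R \<ge> 0\<close> by (meson centre_in_cball less_le_trans less_imp_le order_trans)
  qed (use x in auto)
  then show ?thesis
    using that unfolding h_def by blast
qed

text \<open>Otherwise a hyperplane separates the hull from \<open>0\<close>, and its normal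
  \<open>d\<close> has positive inner product with every negated gradient. A small move along
  \<open>d\<close> then lowers the maximum: active excesses drop by their derivatives, inactive ones
  stay below by continuity.\<close>

lemma minimiser_gradients:
  assumes fin: "finite M" "M \<noteq> {}" "\<And>e. e \<in> M \<Longrightarrow> finite e"
    and min: "\<And>y. Max ((\<lambda>e. excess e x) ` M) \<le> Max ((\<lambda>e. excess e y) ` M)"
    and A: "A = {e\<in>M. excess e x = Max ((\<lambda>e. excess e x) ` M)}"
    and out: "\<And>e. e \<in> A \<Longrightarrow> x \<notin> e"
  shows "0 \<in> convex hull ((\<lambda>e. \<Sum>p\<in>e. sgn (p - x)) ` A)"
proof (rule ccontr)
  let ?s = "\<lambda>e. \<Sum>p\<in>e. sgn (p - x)"
  let ?h = "Max ((\<lambda>e. excess e x) ` M)"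
  assume "0 \<notin> convex hull (?s ` A)"
  moreover have "closed (convex hull (?s ` A))"
    using fin A by (intro compact_imp_closed finite_imp_compact_convex_hull) auto
  ultimately obtain d b where d: "0 < b" "\<forall>y\<in>convex hull (?s ` A). d \<bullet> y > b"
    using separating_hyperplane_closed_0[of "convex hull (?s ` A)"] by auto
  have "\<forall>\<^sub>F t in at_right 0. excess e (x + t *\<^sub>R d) < ?h" if "e \<in> M" for e
  proof (cases "e \<in> A")
    case True
    then have "?s e \<in> convex hull (?s ` A)"
      by (intro hull_inc) auto
    then have "?s e \<bullet> d > 0"
      using d by (auto simp: inner_commute intro: less_trans)
    then show ?thesis
      using excess_decreases[of e x d] True A fin out by auto
  next
    case False
    have "excess e x \<le> ?h"
      using that fin by (intro Max_ge) auto
    then have "excess e x < ?h"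
      using False that A by auto
    moreover have "((\<lambda>t. excess e (x + t *\<^sub>R d)) \<longlongrightarrow> excess e (x + 0 *\<^sub>R d)) (at_right 0)"
      unfolding excess_def by (intro tendsto_intros)
    ultimately show ?thesis
      by (intro order_tendstoD) auto
  qed
  then have "\<forall>\<^sub>F t in at_right 0. \<forall>e\<in>M. excess e (x + t *\<^sub>R d) < ?h"
    using fin by (simp add: eventually_ball_finite)
  then obtain t where "\<forall>e\<in>M. excess e (x + t *\<^sub>R d) < ?h"
    using eventually_happens'[OF trivial_limit_at_right_real] by blast
  then have "Max ((\<lambda>e. excess e (x + t *\<^sub>R d)) ` M) < ?h"
    using fin by (subst Max_less_iff) auto
  then show False
    using min[of "x + t *\<^sub>R d"] by simp
qed

lemma subtends_gradient:
  assumes "subtends x e \<theta> \<alpha>"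
  shows "(\<Sum>p\<in>e. sgn (p - x)) = (2 * cos \<alpha>) *\<^sub>R dir \<theta>"
  using assms unfolding subtends_def by (auto simp: dir_plus_dir)

text \<open>The four distances to \<open>x\<close> sum to more than \<open>sqrt 2\<close> times the
  old length, since both excesses are positive, and to at most \<open>sqrt 2\<close> times the new
  length, since neither new segment is seen under an acute angle.\<close>

lemma swappable_not_local_max:
  assumes M: "local_max k P M" "2 \<le> k" "e \<in> M" "f \<in> M"
    and pos: "excess e x > 0" "excess f x > 0"
    and sub: "subtends x e \<theta> \<alpha>" "subtends x f \<phi> \<beta>"
    and ne: "e \<noteq> f" and sw: "swappable \<theta> \<alpha> \<phi> \<beta>"
  shows False
proof -
  obtain a b where e: "e = {a, b}" "a \<noteq> b" "a \<noteq> x" "b \<noteq> x"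
    "sgn (a - x) = dir (\<theta> - \<alpha>)" "sgn (b - x) = dir (\<theta> + \<alpha>)"
    using sub(1) unfolding subtends_def by blast
  obtain c d where f: "f = {c, d}" "c \<noteq> d" "c \<noteq> x" "d \<noteq> x"
    "sgn (c - x) = dir (\<phi> - \<beta>)" "sgn (d - x) = dir (\<phi> + \<beta>)"
    using sub(2) unfolding subtends_def by blast
  have far: "dist x p + dist x q \<le> sqrt 2 * dist p q"
    if "sgn (p - x) \<bullet> sgn (q - x) \<le> 0" for p q
  proof -
    have "y = norm y *\<^sub>R sgn y" for y :: point
      by (cases "y = 0") (simp_all add: sgn_div_norm)
    then have "(p - x) \<bullet> (q - x) = norm (p - x) * (norm (q - x) * (sgn (p - x) \<bullet> sgn (q - x)))"
      by (metis inner_scaleR_left inner_scaleR_right)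
    also have "\<dots> \<le> 0"
      using that by (simp add: mult_nonneg_nonpos)
    finally show ?thesis
      using sum_norm_le_sqrt2_dist[of "p - x" "q - x"] by (simp add: dist_norm norm_minus_commute)
  qed
  have "dist x a + dist x c \<le> sqrt 2 * dist a c" "dist x b + dist x d \<le> sqrt 2 * dist b d"
    using sw e f unfolding swappable_def by (auto intro!: far simp: inner_dir)
  moreover have "sqrt 2 * dist a b < dist x a + dist x b" "sqrt 2 * dist c d < dist x c + dist x d"
    using pos e f by (auto simp: excess_pair)
  ultimately have "sqrt 2 * (dist a b + dist c d) < sqrt 2 * (dist a c + dist b d)"
    by (simp add: algebra_simps)
  moreover have "dist a c + dist b d \<le> dist a b + dist c d"
    using local_max_swap[OF M(1,2)] M(3,4) e(1,2) f(1,2) ne by auto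
  ultimately show False
    by simp
qed

text \<open>The point \<open>x\<close> lies in the ellipses of all edges at once, so the distances
  of all matched points to it are controlled by \<open>w M\<close>.\<close>

lemma local_max_center:
  assumes M: "local_max k P M" "2 \<le> k" and "finite P" "M \<noteq> {}"
  obtains x where "\<And>e. e \<in> M \<Longrightarrow> excess e x \<le> 0"
proof -
  have pm: "perfect_matching P M"
    using M unfolding local_max_def by blast
  have finM: "finite M"
    using perfect_matching_finite pm assms by blast
  have card2: "card e = 2" if "e \<in> M" for e
    using pm that unfolding perfect_matching_def by blast
  have fin: "finite e" "e \<noteq> {}" if "e \<in> M" for e
    using card2[OF that] by (auto intro: card_ge_0_finite)
  obtain e0 where "e0 \<in> M"
    using assms by auto
  then obtain x where x: "\<And>y. Max ((\<lambda>e. excess e x) ` M) \<le> Max ((\<lambda>e. excess e y) ` M)"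
    using max_excess_attains_min finM fin by metis
  let ?h = "Max ((\<lambda>e. excess e x) ` M)"
  let ?s = "\<lambda>e. \<Sum>p\<in>e. sgn (p - x)"
  define A where "A = {e\<in>M. excess e x = ?h}"
  have "?h \<le> 0"
  proof (rule ccontr)
    assume "\<not> ?h \<le> 0"
    then have pos: "excess e x > 0" if "e \<in> A" for e
      using that by (simp add: A_def)
    have AM: "e \<in> M" if "e \<in> A" for e
      using that by (simp add: A_def)
    have out: "x \<notin> e" if "e \<in> A" for e
      using that pos excess_pos_not_endpoint AM perfect_matching_edgeE[OF pm]
      by (metis empty_iff insert_iff)
    have sub: "\<exists>\<theta> \<alpha>. 0 \<le> \<theta> \<and> \<theta> < 2 * pi \<and> 0 \<le> \<alpha> \<and> \<alpha> < pi / 4 \<and> subtends x e \<theta> \<alpha>"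
      if "e \<in> A" for e
      using that pos AM perfect_matching_edgeE[OF pm] acute_subtends excess_pos_acute by metis
    have "0 \<in> convex hull (?s ` A)"
      by (rule minimiser_gradients[OF finM \<open>M \<noteq> {}\<close> fin(1) x A_def out])
    then obtain e f g p q r where efg: "e \<in> A" "f \<in> A" "g \<in> A" and pqr: "p > 0" "q > 0" "r > 0"
      and z: "p *\<^sub>R ?s e + q *\<^sub>R ?s f + r *\<^sub>R ?s g = 0"
      by (rule zero_in_convex_hull_planarE) blast
    obtain \<theta> \<alpha> where \<theta>: "\<And>e. e \<in> A \<Longrightarrow> 0 \<le> \<theta> e \<and> \<theta> e < 2 * pi \<and> 0 \<le> \<alpha> e \<and> \<alpha> e < pi / 4 \<and>
        subtends x e (\<theta> e) (\<alpha> e)"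
      using sub by metis
    have grad: "?s e = (2 * cos (\<alpha> e)) *\<^sub>R dir (\<theta> e)" if "e \<in> A" for e
      using \<theta>[OF that] subtends_gradient by blast
    have cos_pos: "cos (\<alpha> e) > 0" if "e \<in> A" for e
      using \<theta>[OF that] by (intro cos_gt_zero_pi) auto
    \<comment> \<open>Each gradient is a positive multiple of a bisector direction, and the factor
      is absorbed into its coefficient.\<close>
    have "(p * (2 * cos (\<alpha> e))) *\<^sub>R dir (\<theta> e) + (q * (2 * cos (\<alpha> f))) *\<^sub>R dir (\<theta> f) +
        (r * (2 * cos (\<alpha> g))) *\<^sub>R dir (\<theta> g) = 0"
      using z by (simp only: grad[OF efg(1)] grad[OF efg(2)] grad[OF efg(3)] scaleR_scaleR)
    then have "swappable (\<theta> e) (\<alpha> e) (\<theta> f) (\<alpha> f) \<or> swappable (\<theta> f) (\<alpha> f) (\<theta> g) (\<alpha> g) \<or>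
        swappable (\<theta> e) (\<alpha> e) (\<theta> g) (\<alpha> g)"
      using efg pqr \<theta> cos_pos by (intro swappable_of_positive_combination) auto
    then obtain e f where ef: "e \<in> A" "f \<in> A" "swappable (\<theta> e) (\<alpha> e) (\<theta> f) (\<alpha> f)"
      using efg by blast
    \<comment> \<open>The three edges obtained above may coincide, but an edge paired with itself
      would require \<open>cos 0 \<le> 0\<close>.\<close>
    then have "e \<noteq> f"
      by (auto simp: swappable_def)
    then show False
      using swappable_not_local_max[OF M] ef pos AM \<theta> by blast
  qed
  moreover have "excess e x \<le> ?h" if "e \<in> M" for e
    using that finM by (intro Max_ge) auto
  ultimately show ?thesis
    using that order_trans by blast
qed

theorem theorem4:
  fixes P :: "point set" and M Mstar :: "point set set"
  assumes "finite P" and "even (card P)"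
    and "local_max 3 P M"
    and "max_matching P Mstar"
  shows "w M \<ge> (1 / sqrt 2) * w Mstar"
proof -
  have pm: "perfect_matching P M" "perfect_matching P Mstar"
    using assms unfolding local_max_def max_matching_def by blast+
  \<comment> \<open>For empty \<open>M\<close> the condition is vacuous and any point
    serves.\<close>
  obtain x where x: "\<And>e. e \<in> M \<Longrightarrow> excess e x \<le> 0"
  proof (cases "M = {}")
    case False
    then show ?thesis
      using local_max_center[OF assms(3) _ assms(1)] that by auto
  qed auto
  have "w Mstar \<le> (\<Sum>p\<in>P. dist x p)"
    using w_le_sum_dist pm assms by blast
  also have "\<dots> = (\<Sum>e\<in>M. \<Sum>p\<in>e. dist x p)"
    using sum_perfect_matching pm assms by metis
  also have "\<dots> \<le> (\<Sum>e\<in>M. sqrt 2 * seg_len e)"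
    using x by (intro sum_mono) (simp add: excess_def)
  also have "\<dots> = sqrt 2 * w M"
    by (simp add: w_def sum_distrib_left)
  finally show ?thesis
    by (simp add: field_simps)
qed

end
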